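(* Let $S=\{x_1,x_2,\dots,x_n\}$ be any set of $n$ distinct positive integers, let $m>0$ be a real number, and let $f(x)=x^m$ for all positive integers $x$. Then (a) $(S^{\ast\ast})_f$ is positive definite; (b) $[S^{\ast\ast}]_f$ is indefinite for $n\ge 2$.
   Context: A positive divisor $d$ of a positive integer $n$ is a unitary divisor of $n$, written $d\parallel n$, if $\gcd(d,n/d)=1$. For positive integers $a,b$, $(a,b)^{\ast\ast}$ denotes the greatest common unitary divisor of $a$ and $b$ (the largest $d$ with $d\parallel a$ and $d\parallel b$), and $[a,b]^{\ast\ast}=ab/(a,b)^{\ast\ast}$ is the pseudo-LCUM (pseudo least common unitary multiple). $(S^{\ast\ast})_f$ is the $n\times n$ matrix with $ij$ entry $f((x_i,x_j)^{\ast\ast})$, and $[S^{\ast\ast}]_f$ is the $n\times n$ matrix with $ij$ entry $f([x_i,x_j]^{\ast\ast})$. A real symmetric matrix is indefinite if it is neither positive semidefinite nor negative semidefinite. *)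

theory Defs
  imports Complex_Main "Jordan_Normal_Form.Matrix"
begin

definition unitary_divisor :: "nat \<Rightarrow> nat \<Rightarrow> bool" (infix "\<parallel>\<^sub>u" 50) where
  "d \<parallel>\<^sub>u n \<longleftrightarrow> d dvd n \<and> gcd d (n div d) = 1"

text \<open>The following two notions are meant for positive arguments only.\<close>

definition gcud :: "nat \<Rightarrow> nat \<Rightarrow> nat" where
  "gcud a b = Max {d. d \<parallel>\<^sub>u a \<and> d \<parallel>\<^sub>u b}"

text \<open>The division below is exact, because \<open>gcud a b\<close> divides \<open>a\<close>.\<close>

definition plcum :: "nat \<Rightarrow> nat \<Rightarrow> nat" where
  "plcum a b = a * b div gcud a b"

text \<open>Matrices are indexed from \<open>0\<close>, so \<open>x 0, \<dots>, x (n - 1)\<close> play the role of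
  \<open>x\<^sub>1, \<dots>, x\<^sub>n\<close>.\<close>

definition gcud_matrix :: "(nat \<Rightarrow> real) \<Rightarrow> nat \<Rightarrow> (nat \<Rightarrow> nat) \<Rightarrow> real mat" where
  "gcud_matrix f n x = mat n n (\<lambda>(i, j). f (gcud (x i) (x j)))"

definition plcum_matrix :: "(nat \<Rightarrow> real) \<Rightarrow> nat \<Rightarrow> (nat \<Rightarrow> nat) \<Rightarrow> real mat" where
  "plcum_matrix f n x = mat n n (\<lambda>(i, j). f (plcum (x i) (x j)))"

definition real_symmetric :: "real mat \<Rightarrow> bool" where
  "real_symmetric A \<longleftrightarrow> square_mat A \<and> transpose_mat A = A"

definition positive_definite :: "real mat \<Rightarrow> bool" where
  "positive_definite A \<longleftrightarrow> real_symmetric A \<and>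
     (\<forall>v \<in> carrier_vec (dim_row A). v \<noteq> 0\<^sub>v (dim_row A) \<longrightarrow> v \<bullet> (A *\<^sub>v v) > 0)"

definition positive_semidefinite :: "real mat \<Rightarrow> bool" where
  "positive_semidefinite A \<longleftrightarrow> real_symmetric A \<and>
     (\<forall>v \<in> carrier_vec (dim_row A). v \<bullet> (A *\<^sub>v v) \<ge> 0)"

definition negative_semidefinite :: "real mat \<Rightarrow> bool" where
  "negative_semidefinite A \<longleftrightarrow> real_symmetric A \<and>
     (\<forall>v \<in> carrier_vec (dim_row A). v \<bullet> (A *\<^sub>v v) \<le> 0)"

text \<open>Symmetry is demanded here separately: a non-symmetric matrix would otherwise count as
  indefinite.\<close>

definition indefinite :: "real mat \<Rightarrow> bool" where
  "indefinite A \<longleftrightarrow> real_symmetric A \<and>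
     \<not> positive_semidefinite A \<and> \<not> negative_semidefinite A"

end

theory Submission
  imports Defs "HOL-Computational_Algebra.Primes"
begin

text \<open>
  A positive integer is determined by the finite set of pairs \<open>(p, k)\<close> such that \<open>p ^ k\<close> is the
  exact power of the prime \<open>p\<close> in it. Unitary divisors correspond to subsets of this set, since a
  unitary divisor takes each exact prime power wholly or not at all. So the greatest common unitary
  divisor corresponds to the intersection (\<open>gcud_eq_prod\<close>), and \<open>(gcud a b) powr m\<close> is the product
  of the weights \<open>(p ^ k) powr m > 1\<close> over the intersection of two finite sets.

  Part (a) then holds for every family of distinct finite sets (\<open>intersection_kernel_pos\<close>).
  Expanding the product of \<open>1 + (w a - 1)\<close> over \<open>A i \<inter> A j\<close> gives a sum over all \<open>T\<close> contained in
  both \<open>A i\<close> and \<open>A j\<close>, with positive coefficients \<open>\<Prod>a\<in>T. (w a - 1)\<close>. The quadratic form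
  thereby becomes a positive combination of the squares of \<open>\<Sum>i | T \<subseteq> A i. v i\<close>. If \<open>v \<noteq> 0\<close>, at least
  one square is nonzero: for a largest \<open>A k\<close> with \<open>v k \<noteq> 0\<close>, the sum for \<open>T = A k\<close> is just \<open>v k\<close>.

  For part (b), two distinct entries \<open>a\<close> and \<open>b\<close> of \<open>S\<close> suffice. The diagonal entries are positive,
  so the form takes a positive value. With \<open>g = gcud a b\<close>, the principal minor on these two
  indices is \<open>(a b) powr m - (a b / g) powr (2 m)\<close>, and it is negative because \<open>g\<^sup>2 < a b\<close>, so the
  form also takes a negative value.
\<close>

section \<open>The kernel of weighted intersections\<close>

text \<open>The bound \<open>w a > 1\<close> makes every coefficient \<open>\<Prod>a\<in>T. (w a - 1)\<close> of the expansion over subsets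
  positive; injectivity makes the largest \<open>A k\<close> with \<open>v k \<noteq> 0\<close> isolate a single coordinate.\<close>

lemma intersection_kernel_pos:
  fixes A :: "'i \<Rightarrow> 'a set" and w :: "'a \<Rightarrow> real" and v :: "'i \<Rightarrow> real"
  assumes fin: "finite I" "\<And>i. i \<in> I \<Longrightarrow> finite (A i)"
    and inj: "inj_on A I"
    and w: "\<And>i a. i \<in> I \<Longrightarrow> a \<in> A i \<Longrightarrow> w a > 1"
    and k0: "k0 \<in> I" "v k0 \<noteq> 0"
  shows "0 < (\<Sum>i\<in>I. \<Sum>j\<in>I. v i * (\<Prod>a\<in>A i \<inter> A j. w a) * v j)"
proof -
  define U where "U = Pow (\<Union>i\<in>I. A i)"
  define g where "g T = (\<Prod>a\<in>T. w a - 1)" for T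
  define s where "s T = (\<Sum>i\<in>I. v i * of_bool (T \<subseteq> A i))" for T
  have finU: "finite U"
    using fin by (simp add: U_def)
  have g_pos: "g T > 0" if "T \<in> U" for T
    unfolding g_def using that w by (intro prod_pos) (force simp: U_def)
  have expand: "(\<Prod>a\<in>A i \<inter> A j. w a) = (\<Sum>T\<in>U. g T * of_bool (T \<subseteq> A i) * of_bool (T \<subseteq> A j))"
    if "i \<in> I" "j \<in> I" for i j
  proof -
    have "(\<Prod>a\<in>A i \<inter> A j. w a) = (\<Prod>a\<in>A i \<inter> A j. (w a - 1) + 1)"
      by simp
    also have "\<dots> = (\<Sum>T\<in>Pow (A i \<inter> A j). g T)"
      using fin that by (subst prod_add) (auto simp: g_def)
    also have "\<dots> = (\<Sum>T\<in>U. g T * of_bool (T \<subseteq> A i) * of_bool (T \<subseteq> A j))"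
      using finU that by (intro sum.mono_neutral_cong_left) (auto simp: U_def)
    finally show ?thesis .
  qed
  have "(\<Sum>i\<in>I. \<Sum>j\<in>I. v i * (\<Prod>a\<in>A i \<inter> A j. w a) * v j)
      = (\<Sum>i\<in>I. \<Sum>j\<in>I. \<Sum>T\<in>U. g T * (v i * of_bool (T \<subseteq> A i)) * (v j * of_bool (T \<subseteq> A j)))"
    by (intro sum.cong refl) (simp add: expand sum_distrib_left sum_distrib_right mult_ac)
  also have "\<dots> = (\<Sum>i\<in>I. \<Sum>T\<in>U. \<Sum>j\<in>I. g T * (v i * of_bool (T \<subseteq> A i)) * (v j * of_bool (T \<subseteq> A j)))"
    by (intro sum.cong refl sum.swap)
  also have "\<dots> = (\<Sum>T\<in>U. \<Sum>i\<in>I. \<Sum>j\<in>I. g T * (v i * of_bool (T \<subseteq> A i)) * (v j * of_bool (T \<subseteq> A j)))"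
    by (rule sum.swap)
  also have "\<dots> = (\<Sum>T\<in>U. g T * (s T)\<^sup>2)"
    unfolding s_def power2_eq_square sum_product
    by (simp only: sum_distrib_left mult.assoc)
  finally have form: "(\<Sum>i\<in>I. \<Sum>j\<in>I. v i * (\<Prod>a\<in>A i \<inter> A j. w a) * v j) = (\<Sum>T\<in>U. g T * (s T)\<^sup>2)" .
  obtain k where k: "k \<in> I" "v k \<noteq> 0"
    and max: "\<And>i. i \<in> I \<Longrightarrow> v i \<noteq> 0 \<Longrightarrow> card (A i) \<le> card (A k)"
  proof -
    define J where "J = {i \<in> I. v i \<noteq> 0}"
    have "finite J" "J \<noteq> {}"
      using fin k0 by (auto simp: J_def)
    then have "\<exists>k\<in>J. \<forall>i\<in>J. card (A i) \<le> card (A k)"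
      using obtains_MAX[of J "\<lambda>i. card (A i)"]
      by (metis (no_types, lifting) Max_ge finite_imageI image_eqI)
    then show thesis
      using that by (auto simp: J_def)
  qed
  have others: "v i * of_bool (A k \<subseteq> A i) = 0" if "i \<in> I" "i \<noteq> k" for i
  proof (rule ccontr)
    assume "v i * of_bool (A k \<subseteq> A i) \<noteq> 0"
    then have i: "v i \<noteq> 0" "A k \<subseteq> A i"
      by auto
    then have "A k = A i"
      using card_seteq[of "A i" "A k"] max fin that by simp
    then show False
      using inj that k by (auto dest: inj_onD)
  qed
  have "s (A k) = v k + (\<Sum>i\<in>I - {k}. v i * of_bool (A k \<subseteq> A i))"
    unfolding s_def using fin k by (subst sum.remove[of _ k]) auto
  also have "(\<Sum>i\<in>I - {k}. v i * of_bool (A k \<subseteq> A i)) = 0"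
    using others by (intro sum.neutral) simp
  finally have "s (A k) = v k"
    by simp
  moreover have "A k \<in> U"
    using k by (auto simp: U_def)
  ultimately have "0 < g (A k) * (s (A k))\<^sup>2"
    using g_pos[of "A k"] k by simp
  then show ?thesis
    unfolding form using finU g_pos \<open>A k \<in> U\<close>
    by (intro sum_pos2[where i = "A k"]) (auto simp: less_imp_le)
qed

section \<open>Unitary divisors as sets of exact prime powers\<close>

definition prime_components :: "nat \<Rightarrow> (nat \<times> nat) set" where
  "prime_components n = (\<lambda>p. (p, multiplicity p n)) ` prime_factors n"

lemma mem_prime_components_iff:
  "(p, k) \<in> prime_components n \<longleftrightarrow> p \<in> prime_factors n \<and> k = multiplicity p n"
  by (auto simp: prime_components_def)

lemma finite_prime_components [simp]: "finite (prime_components n)"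
  by (simp add: prime_components_def)

lemma prod_prime_components:
  assumes "n > 0"
  shows "(\<Prod>(p, k)\<in>prime_components n. p ^ k) = n"
  using prime_factorization_nat[OF assms]
  by (simp add: prime_components_def prod.reindex inj_on_def)

lemma inj_on_prime_components: "inj_on prime_components {0<..}"
  by (rule inj_onI) (metis greaterThan_iff prod_prime_components)

text \<open>Each prime occurs in at most one pair of \<open>T\<close>, with a positive exponent, so multiplying out
  neither merges nor loses components. This realises every intersection as an actual integer.\<close>

lemma prime_components_prod_subset:
  assumes "T \<subseteq> prime_components n"
  shows "(\<Prod>(p, k)\<in>T. p ^ k) > 0"
    and "prime_components (\<Prod>(p, k)\<in>T. p ^ k) = T"
proof -
  define P where "P = fst ` T"
  have P: "finite P" "P \<subseteq> prime_factors n"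
    using assms finite_subset[OF assms] by (auto simp: P_def mem_prime_components_iff)
  have T: "T = (\<lambda>p. (p, multiplicity p n)) ` P"
    using assms by (force simp: P_def mem_prime_components_iff)
  have prod: "(\<Prod>(p, k)\<in>T. p ^ k) = (\<Prod>p\<in>P. p ^ multiplicity p n)"
    by (simp add: T prod.reindex inj_on_def)
  show pos: "(\<Prod>(p, k)\<in>T. p ^ k) > 0"
    unfolding prod using P by (intro prod_pos) (auto simp: prime_gt_0_nat in_prime_factors_iff)
  have mult: "multiplicity p (\<Prod>(p, k)\<in>T. p ^ k) = (if p \<in> P then multiplicity p n else 0)"
    if "prime p" for p
    unfolding prod using P that by (intro multiplicity_prod_prime_powers) auto
  have "prime_factors (\<Prod>(p, k)\<in>T. p ^ k) = P"
    using mult P by (auto simp: prime_factors_multiplicity split: if_splits)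
  moreover have "prime p" if "p \<in> P" for p
    using P that by auto
  ultimately show "prime_components (\<Prod>(p, k)\<in>T. p ^ k) = T"
    using mult by (subst T, simp add: prime_components_def)
qed

text \<open>The factors of \<open>n = d * e\<close> are coprime exactly when every prime has its full multiplicity in
  one of them.\<close>

lemma unitary_divisor_iff_prime_components:
  assumes "d > 0" "n > 0"
  shows "d \<parallel>\<^sub>u n \<longleftrightarrow> prime_components d \<subseteq> prime_components n"
proof
  assume "d \<parallel>\<^sub>u n"
  then obtain e where e: "n = d * e" "coprime d e"
    using assms by (auto simp: unitary_divisor_def coprime_iff_gcd_eq_1)
  show "prime_components d \<subseteq> prime_components n"
  proof (clarsimp simp: prime_components_def)
    fix p assume p: "p \<in> prime_factors d"
    then have "\<not> p dvd e"
      using e by (meson coprime_common_divisor in_prime_factors_iff not_prime_unit)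
    then have "multiplicity p n = multiplicity p d"
      using e p assms
      by (simp add: prime_elem_multiplicity_mult_distrib not_dvd_imp_multiplicity_0 in_prime_factors_iff)
    moreover have "p \<in> prime_factors n"
      using e p assms by (auto simp: in_prime_factors_iff)
    ultimately show "(p, multiplicity p d) \<in> (\<lambda>p. (p, multiplicity p n)) ` prime_factors n"
      by auto
  qed
next
  assume sub: "prime_components d \<subseteq> prime_components n"
  have mult: "multiplicity p d = multiplicity p n" if "p \<in> prime_factors d" for p
    using sub that mem_prime_components_iff by blast
  have "d dvd n"
  proof (rule multiplicity_le_imp_dvd)
    fix p :: nat assume "prime p"
    then show "multiplicity p d \<le> multiplicity p n"
      using mult[of p] by (cases "p \<in> prime_factors d") (auto simp: prime_factors_multiplicity)
  qed (use assms in simp)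
  then obtain e where e: "n = d * e"
    by blast
  have "coprime d e"
  proof (rule ccontr)
    assume "\<not> coprime d e"
    then obtain p where p: "prime p" "p dvd d" "p dvd e"
      by (metis coprime_iff_gcd_eq_1 dvd_trans gcd_dvd1 gcd_dvd2 prime_factor_nat)
    have "multiplicity p n = multiplicity p d + multiplicity p e"
      using e p assms by (simp add: prime_elem_multiplicity_mult_distrib)
    moreover have "multiplicity p e > 0"
      using p e assms by (simp add: prime_multiplicity_gt_zero_iff)
    moreover have "p \<in> prime_factors d"
      using p assms by (simp add: in_prime_factors_iff)
    ultimately show False
      using mult by simp
  qed
  then show "d \<parallel>\<^sub>u n"
    using e assms by (simp add: unitary_divisor_def)
qed

text \<open>The product over the intersection is a common unitary divisor, and every other one is
  not only smaller but itself a unitary divisor of it.\<close>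

lemma gcud_eq_prod:
  assumes "a > 0" "b > 0"
  shows "gcud a b = (\<Prod>(p, k)\<in>prime_components a \<inter> prime_components b. p ^ k)" (is "_ = ?g")
proof -
  have g: "?g > 0" "prime_components ?g = prime_components a \<inter> prime_components b"
    by (rule prime_components_prod_subset[of _ a]; blast)+
  have common: "{d. d \<parallel>\<^sub>u a \<and> d \<parallel>\<^sub>u b} = {d. d \<parallel>\<^sub>u ?g}"
  proof (intro Collect_cong)
    fix d
    show "d \<parallel>\<^sub>u a \<and> d \<parallel>\<^sub>u b \<longleftrightarrow> d \<parallel>\<^sub>u ?g"
    proof (cases "d = 0")
      case True
      then show ?thesis
        using assms g(1) by (simp add: unitary_divisor_def)
    next
      case False
      then show ?thesis
        using assms g by (simp add: unitary_divisor_iff_prime_components)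
    qed
  qed
  have le: "d \<le> ?g" if "d \<parallel>\<^sub>u ?g" for d
    using that g(1) by (auto simp: unitary_divisor_def intro: dvd_imp_le)
  have "?g \<parallel>\<^sub>u ?g"
    using g(1) by (simp add: unitary_divisor_def)
  then show ?thesis
    unfolding gcud_def common using le
    by (intro Max_eqI) (auto intro: finite_subset[of _ "{..?g}"])
qed

lemma gcud_commute: "gcud a b = gcud b a"
  by (simp add: gcud_def conj_commute)

lemma gcud_self:
  assumes "a > 0"
  shows "gcud a a = a"
  using assms by (simp add: gcud_eq_prod prod_prime_components)

lemma gcud_pos_dvd:
  assumes "a > 0" "b > 0"
  shows "gcud a b > 0" "gcud a b dvd a" "gcud a b dvd b"
proof -
  have g: "gcud a b > 0" "prime_components (gcud a b) = prime_components a \<inter> prime_components b"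
    unfolding gcud_eq_prod[OF assms] by (rule prime_components_prod_subset[of _ a]; blast)+
  then have "gcud a b \<parallel>\<^sub>u a" "gcud a b \<parallel>\<^sub>u b"
    using assms by (simp_all add: unitary_divisor_iff_prime_components)
  with g show "gcud a b > 0" "gcud a b dvd a" "gcud a b dvd b"
    by (simp_all add: unitary_divisor_def)
qed

lemma gcud_square_less:
  assumes "a > 0" "b > 0" "a \<noteq> b"
  shows "gcud a b * gcud a b < a * b"
proof -
  have le: "gcud a b \<le> a" "gcud a b \<le> b"
    using gcud_pos_dvd[OF assms(1,2)] assms by (auto intro: dvd_imp_le)
  show ?thesis
  proof (cases "gcud a b = a")
    case True
    then show ?thesis
      using le assms by simp
  next
    case False
    then show ?thesis
      using le assms gcud_pos_dvd(1)[OF assms(1,2)] by (intro mult_less_le_imp_less) auto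
  qed
qed

lemma real_plcum:
  assumes "a > 0" "b > 0"
  shows "real (plcum a b) = real a * real b / real (gcud a b)"
  using gcud_pos_dvd[OF assms] by (simp add: plcum_def real_of_nat_div)

lemma gcud_powr:
  assumes "a > 0" "b > 0"
  shows "real (gcud a b) powr m
    = (\<Prod>(p, k)\<in>prime_components a \<inter> prime_components b. real (p ^ k) powr m)"
  unfolding gcud_eq_prod[OF assms] of_nat_prod
  by (subst prod_powr_distrib) (auto simp: case_prod_beta)

section \<open>Quadratic forms\<close>

lemma quadratic_form_mat:
  fixes h :: "nat \<times> nat \<Rightarrow> real"
  assumes "v \<in> carrier_vec n"
  shows "v \<bullet> (mat n n h *\<^sub>v v) = (\<Sum>i<n. \<Sum>j<n. v $ i * h (i, j) * v $ j)"
  using assms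
  by (simp add: scalar_prod_def sum_distrib_left mult.assoc atLeast0LessThan)

text \<open>The form evaluated at \<open>s e\<^sub>0 + t e\<^sub>1\<close>: only the leading two-by-two block matters.\<close>

lemma quadratic_form_leading_block:
  fixes h :: "nat \<times> nat \<Rightarrow> real"
  assumes "n \<ge> 2"
  shows "\<exists>v \<in> carrier_vec n. v \<bullet> (mat n n h *\<^sub>v v)
    = s * h (0, 0) * s + s * h (0, 1) * t + t * h (1, 0) * s + t * h (1, 1) * t"
proof
  define c :: "nat \<Rightarrow> real" where "c i = (if i = 0 then s else if i = 1 then t else 0)" for i
  have cut: "(\<Sum>i<n. F i) = F 0 + F 1" if "\<And>i. i \<ge> 2 \<Longrightarrow> F i = 0" for F :: "nat \<Rightarrow> real"
  proof -
    have "(\<Sum>i<n. F i) = (\<Sum>i<2. F i)"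
      using assms that by (intro sum.mono_neutral_right) auto
    then show ?thesis
      by (simp add: numeral_2_eq_2)
  qed
  have "vec n c \<bullet> (mat n n h *\<^sub>v vec n c) = (\<Sum>i<n. \<Sum>j<n. c i * h (i, j) * c j)"
    by (subst quadratic_form_mat) auto
  also have "\<dots> = (\<Sum>i<n. c i * h (i, 0) * c 0 + c i * h (i, 1) * c 1)"
    by (intro sum.cong refl cut) (simp add: c_def)
  also have "\<dots> = s * h (0, 0) * s + s * h (0, 1) * t + t * h (1, 0) * s + t * h (1, 1) * t"
    by (subst cut) (auto simp: c_def)
  finally show "vec n c \<bullet> (mat n n h *\<^sub>v vec n c)
    = s * h (0, 0) * s + s * h (0, 1) * t + t * h (1, 0) * s + t * h (1, 1) * t" .
qed simp

section \<open>Power GCUD and pseudo-LCUM matrices\<close>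

theorem gcud_matrix_power_positive_definite:
  fixes x :: "nat \<Rightarrow> nat" and m :: real and f :: "nat \<Rightarrow> real"
  assumes inj: "inj_on x {..<n}" and pos: "\<And>i. i < n \<Longrightarrow> x i > 0"
    and m: "m > 0" and f: "\<And>k. k > 0 \<Longrightarrow> f k = real k powr m"
  shows "positive_definite (gcud_matrix f n x)"
proof -
  define w where "w = (\<lambda>(p, k). real (p ^ k) powr m)"
  have "0 < v \<bullet> (gcud_matrix f n x *\<^sub>v v)" if v: "v \<in> carrier_vec n" "v \<noteq> 0\<^sub>v n" for v
  proof -
    obtain k where k: "k < n" "v $ k \<noteq> 0"
      using v by (metis eq_vecI carrier_vecD index_zero_vec)
    have "inj_on (prime_components \<circ> x) {..<n}"
      using inj pos by (intro comp_inj_on inj_on_subset[OF inj_on_prime_components]) auto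
    moreover have "w a > 1" if "i < n" "a \<in> prime_components (x i)" for i a
    proof -
      obtain p where p: "p \<in> prime_factors (x i)" "a = (p, multiplicity p (x i))"
        using \<open>a \<in> prime_components (x i)\<close> by (auto simp: prime_components_def)
      then have "multiplicity p (x i) > 0" "prime p"
        by (auto simp: prime_factors_multiplicity)
      then have "p ^ multiplicity p (x i) > 1"
        by (intro one_less_power prime_gt_1_nat)
      then have "real (p ^ multiplicity p (x i)) > 1"
        by linarith
      then show ?thesis
        using m p by (simp only: w_def prod.case) (rule gr_one_powr)
    qed
    ultimately have "0 < (\<Sum>i<n. \<Sum>j<n. v $ i *
        (\<Prod>a\<in>prime_components (x i) \<inter> prime_components (x j). w a) * v $ j)"
      using k intersection_kernel_pos[of "{..<n}" "prime_components \<circ> x" w k "\<lambda>i. v $ i"] by simp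
    also have "\<dots> = (\<Sum>i<n. \<Sum>j<n. v $ i * f (gcud (x i) (x j)) * v $ j)"
      using pos by (intro sum.cong refl) (simp add: f gcud_pos_dvd(1) gcud_powr w_def)
    also have "\<dots> = v \<bullet> (gcud_matrix f n x *\<^sub>v v)"
      using v by (simp add: gcud_matrix_def quadratic_form_mat)
    finally show ?thesis .
  qed
  moreover have "real_symmetric (gcud_matrix f n x)"
    by (auto simp: real_symmetric_def gcud_matrix_def intro!: eq_matI) (metis gcud_commute)
  ultimately show ?thesis
    by (simp add: positive_definite_def gcud_matrix_def)
qed

theorem plcum_matrix_power_indefinite:
  fixes x :: "nat \<Rightarrow> nat" and m :: real and f :: "nat \<Rightarrow> real"
  assumes inj: "inj_on x {..<n}" and pos: "\<And>i. i < n \<Longrightarrow> x i > 0"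
    and m: "m > 0" and f: "\<And>k. k > 0 \<Longrightarrow> f k = real k powr m"
    and n: "n \<ge> 2"
  shows "indefinite (plcum_matrix f n x)"
proof -
  define a where "a = x 0"
  define b where "b = x 1"
  have ab: "a > 0" "b > 0" "a \<noteq> b"
    using n pos inj_onD[OF inj, of 0 1] by (auto simp: a_def b_def)
  have comm: "plcum c d = plcum d c" for c d
    by (simp add: plcum_def gcud_commute mult.commute)
  have sym: "real_symmetric (plcum_matrix f n x)"
    by (auto simp: real_symmetric_def plcum_matrix_def comm intro!: eq_matI)
  define L where "L = f (plcum a b)"
  have entries: "f (plcum a a) = f a" "f (plcum b b) = f b" "f (plcum b a) = L"
    using ab comm[of b a] by (simp_all add: plcum_def gcud_self L_def)
  have form: "\<exists>v \<in> carrier_vec n. v \<bullet> (plcum_matrix f n x *\<^sub>v v)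
      = s * s * f a + 2 * s * t * L + t * t * f b" for s t
    using quadratic_form_leading_block[OF n, of "\<lambda>(i, j). f (plcum (x i) (x j))" s t]
    by (simp only: plcum_matrix_def prod.case entries L_def[symmetric] a_def[symmetric]
        b_def[symmetric]) (simp add: algebra_simps)
  have fa: "f a > 0"
    using ab f by simp
  \<comment> \<open>The off-diagonal entry exceeds the geometric mean of the two diagonal ones.\<close>
  have det: "f a * f b < L * L"
  proof -
    define g where "g = gcud a b"
    have g: "g > 0" "real g * real g < real a * real b"
      using gcud_pos_dvd(1)[OF ab(1,2)] gcud_square_less[OF ab]
      by (simp_all add: g_def flip: of_nat_mult)
    have q: "real (plcum a b) = real a * real b / real g"
      using ab by (simp add: real_plcum g_def)
    then have "plcum a b > 0"
      using ab g by (metis divide_pos_pos mult_pos_pos of_nat_0_less_iff)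
    have "real a * real b * (real g * real g) < real a * real b * (real a * real b)"
      using g(2) ab by (intro mult_strict_left_mono) auto
    then have "real a * real b < real (plcum a b) * real (plcum a b)"
      using g(1) by (simp add: q field_simps)
    then have "(real a * real b) powr m < (real (plcum a b) * real (plcum a b)) powr m"
      using m by (intro powr_less_mono2) auto
    then show ?thesis
      using ab \<open>plcum a b > 0\<close> by (simp add: L_def f powr_mult)
  qed
  have "\<not> negative_semidefinite (plcum_matrix f n x)"
    using form[of 1 0] fa by (force simp: negative_semidefinite_def plcum_matrix_def)
  moreover have "\<not> positive_semidefinite (plcum_matrix f n x)"
  proof
    assume psd: "positive_semidefinite (plcum_matrix f n x)"
    \<comment> \<open>For fixed second coordinate \<open>- f a\<close>, the form is smallest at first coordinate \<open>L\<close>.\<close>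
    obtain v where v: "v \<in> carrier_vec n" "v \<bullet> (plcum_matrix f n x *\<^sub>v v)
        = L * L * f a + 2 * L * (- f a) * L + (- f a) * (- f a) * f b"
      using form[of L "- f a"] by blast
    have "v \<bullet> (plcum_matrix f n x *\<^sub>v v) = f a * (f a * f b - L * L)"
      unfolding v(2) by (simp add: algebra_simps)
    also have "\<dots> < 0"
      using fa det by (simp add: mult_pos_neg)
    finally show False
      using psd v(1) by (force simp: positive_semidefinite_def plcum_matrix_def)
  qed
  ultimately show ?thesis
    using sym by (simp add: indefinite_def)
qed

theorem theorem5p7:
  fixes S :: "nat set" and n :: nat and x :: "nat \<Rightarrow> nat"
    and m :: real and f :: "nat \<Rightarrow> real"
  assumes "bij_betw x {..<n} S"
    and "\<forall>s\<in>S. s > 0"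
    and "m > 0"
    and "\<forall>k>0. f k = real k powr m"
  shows "positive_definite (gcud_matrix f n x) \<and>
    (n \<ge> 2 \<longrightarrow> indefinite (plcum_matrix f n x))"
proof -
  have "inj_on x {..<n}" and "\<And>i. i < n \<Longrightarrow> x i > 0"
    using assms(1,2) by (auto simp: bij_betw_def)
  with assms(3,4) show ?thesis
    by (simp add: gcud_matrix_power_positive_definite plcum_matrix_power_indefinite)
qed

end
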